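(* Let $d \ge 1$ be an integer and let $D$ be a regular bounded domain in $\mathbb{R}^d$. Let $\theta \in D$ and let $Y$ be a random vector taking values in $\partial D$, distributed according to the harmonic measure on $\partial D$ parametrized by $\theta$, i.e. $Y \sim \mathcal{H}_\theta^D$. Then $\mathbb{E}[Y] = \theta$.
   Context: A domain in $\mathbb{R}^d$ is an open connected set (non-empty here, since it contains $\theta$). Let $\{X_t\}_{t \ge 0}$ be a standard Brownian motion in $\mathbb{R}^d$, and let $\tau_D = \inf\{t > 0 : X_t \notin D\}$ be its exit time from $D$ (the hitting time of $D^c$). A point $z \in \partial D$ is a regular boundary point of $D$ if $\mathbb{P}\{\tau_D = 0 \mid X_0 = z\} = 1$. The domain $D$ is regular if all points of $\partial D$ are regular boundary points. Harmonic measure: for a Borel measurable set $E \subseteq \partial D$ and $x \in D$, $\omega(x,E,D)$ denotes the value at $x$ of the harmonic extension into $D$ of the boundary data $\mathbf{1}_E$. As a function of $x$ it is harmonic in $D$, and for fixed $x$ it is a measure in $E$. For a regular bounded domain $D$, by Kakutani's theorem, this is equivalently the exit distribution of Brownian motion: $$\omega(x,E,D) = \mathbb{P}\{X_{\tau_D} \in E \mid X_0 = x\}.$$ For $\theta \in D$, the notation $Y \sim \mathcal{H}_\theta^D$ means that $Y$ is a random vector on $\partial D$ with $\mathbb{P}\{Y \in E\} = \omega(\theta,E,D)$ for every Borel measurable $E \subseteq \partial D$; equivalently (for $D$ bounded and regular), $Y$ has the same distribution as the exit point $X_{\tau_D}$ from $D$ of a Brownian motion started at $\theta$. *)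

theory Defs
  imports "HOL-Probability.Probability"
begin

definition domain :: "'a::euclidean_space set \<Rightarrow> bool" where
  "domain D \<longleftrightarrow> open D \<and> connected D \<and> D \<noteq> {}"

(* Standard Brownian motion started at the origin; only the values at times t >= 0 matter.
   Started at x, it is the translated process x + W t. *)
locale standard_brownian_motion = prob_space M
  for M :: "'w measure" and W :: "real \<Rightarrow> 'w \<Rightarrow> 'a::euclidean_space" +
  assumes random_variable_W: "\<And>t. 0 \<le> t \<Longrightarrow> random_variable borel (W t)"
    and start: "\<And>w. w \<in> space M \<Longrightarrow> W 0 w = 0"
    and continuous_paths: "\<And>w. w \<in> space M \<Longrightarrow> continuous_on {0..} (\<lambda>t. W t w)"
    and independent_increments:
      "\<And>(ts :: nat \<Rightarrow> real) n. 0 \<le> ts 0 \<Longrightarrow> strict_mono_on {..n} ts \<Longrightarrow>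
         indep_vars (\<lambda>_. borel) (\<lambda>i w. W (ts (Suc i)) w - W (ts i) w) {..<n}"
    and gaussian_increments:
      "\<And>s t. 0 \<le> s \<Longrightarrow> s < t \<Longrightarrow>
         distributed M lborel (\<lambda>w. W t w - W s w)
           (\<lambda>x. ennreal (\<Prod>b\<in>Basis. normal_density 0 (sqrt (t - s)) (x \<bullet> b)))"

(* The infimum is taken in the extended reals, so that a path that never leaves D has
   exit time infinity. *)
definition exit_time :: "'a set \<Rightarrow> (real \<Rightarrow> 'a) \<Rightarrow> ereal" where
  "exit_time D p = Inf (ereal ` {t. 0 < t \<and> p t \<notin> D})"

definition regular_boundary_point ::
  "'w measure \<Rightarrow> (real \<Rightarrow> 'w \<Rightarrow> 'a) \<Rightarrow> 'a::euclidean_space set \<Rightarrow> 'a \<Rightarrow> bool" where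
  "regular_boundary_point M W D z \<longleftrightarrow>
     z \<in> frontier D \<and> measure M {w \<in> space M. exit_time D (\<lambda>t. z + W t w) = 0} = 1"

definition regular_domain ::
  "'w measure \<Rightarrow> (real \<Rightarrow> 'w \<Rightarrow> 'a) \<Rightarrow> 'a::euclidean_space set \<Rightarrow> bool" where
  "regular_domain M W D \<longleftrightarrow>
     domain D \<and> (\<forall>z\<in>frontier D. regular_boundary_point M W D z)"

(* Lower semicontinuous, with volume averages over closed balls in D bounded by the value at the
   centre. Integrability on the balls, automatic for finite-valued superharmonic functions, is
   demanded because the Bochner integral of a non-integrable function is 0. *)
definition superharmonic_on :: "'a::euclidean_space set \<Rightarrow> ('a \<Rightarrow> real) \<Rightarrow> bool" where
  "superharmonic_on D u \<longleftrightarrow>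
     (\<forall>x\<in>D. ereal (u x) \<le> Liminf (at x) (\<lambda>y. ereal (u y))) \<and>
     (\<forall>x r. 0 < r \<longrightarrow> cball x r \<subseteq> D \<longrightarrow>
        set_integrable lborel (cball x r) u \<and>
        (LINT y:cball x r|lborel. u y) / measure lborel (cball x r) \<le> u x)"

definition upper_class :: "'a::euclidean_space set \<Rightarrow> ('a \<Rightarrow> real) \<Rightarrow> ('a \<Rightarrow> real) set" where
  "upper_class D f =
     {u. superharmonic_on D u \<and>
         (\<forall>z\<in>frontier D. ereal (f z) \<le> Liminf (at z within D) (\<lambda>x. ereal (u x)))}"

(* The harmonic extension of possibly discontinuous boundary data is the
   Perron-Wiener-Brelot solution of the Dirichlet problem. For bounded D and bounded Borel f the
   upper and the lower Perron solution agree (Wiener, Brelot), so the upper one is used; and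
   for such f the value is not affected by admitting only finite-valued superharmonic functions,
   since they may be truncated at the supremum of f. *)
definition harmonic_extension :: "'a::euclidean_space set \<Rightarrow> ('a \<Rightarrow> real) \<Rightarrow> 'a \<Rightarrow> real" where
  "harmonic_extension D f x = (INF u\<in>upper_class D f. u x)"

definition harmonic_measure :: "'a::euclidean_space \<Rightarrow> 'a set \<Rightarrow> 'a set \<Rightarrow> real" where
  "harmonic_measure x E D = harmonic_extension D (indicator E) x"

definition harmonically_distributed ::
  "'v measure \<Rightarrow> ('v \<Rightarrow> 'a) \<Rightarrow> 'a::euclidean_space \<Rightarrow> 'a set \<Rightarrow> bool" where
  "harmonically_distributed N Y \<theta> D \<longleftrightarrow>
     Y \<in> borel_measurable N \<and>
     (\<forall>w\<in>space N. Y w \<in> frontier D) \<and>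
     (\<forall>E\<in>sets borel. E \<subseteq> frontier D \<longrightarrow>
        measure N {w \<in> space N. Y w \<in> E} = harmonic_measure \<theta> E D)"

end

theory Submission
  imports Defs
begin

text \<open>
  Every affine function \<open>h\<close> is harmonic, so its value at \<open>\<theta>\<close> should be its mean against the harmonic
  measure of \<open>\<theta>\<close>; applied to the coordinates this says that the mean of \<open>Y\<close> is \<open>\<theta>\<close>. It is enough
  to prove the single inequality \<open>h \<theta> \<le> E (h Y)\<close> for subharmonic \<open>h\<close>
  (\<open>subharmonic_le_expectation\<close>), because both \<open>h\<close> and \<open>- h\<close> are subharmonic when \<open>h\<close> is
  affine.

  This inequality uses harmonic measure only through its definition as an infimum over upper
  functions. Up to an additive constant, \<open>h\<close> is
  nonnegative on the boundary, and it lies there below a simple function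
  \<open>\<Sum>i. c i * indicator (E i)\<close> with \<open>c i \<ge> 0\<close> that exceeds it by at most \<open>e\<close>.
  For each \<open>i\<close> there is an upper function of \<open>indicator (E i)\<close> whose value at \<open>\<theta>\<close> is as close as
  desired to the harmonic measure of \<open>E i\<close>. Upper functions form a convex cone
  (\<open>upper_class_sum\<close>), so combining these with the weights \<open>c i\<close> gives an upper function of the
  simple function, and by the minimum principle (\<open>superharmonic_minimum_principle\<close>) it dominates
  \<open>h\<close> at \<open>\<theta>\<close>. Hence \<open>h \<theta> \<le> \<Sum>i. c i * harmonic_measure \<theta> (E i) D\<close>. Since \<open>Y\<close> has a genuine
  probability law with these values, the right-hand side is the expectation of the simple function
  of \<open>Y\<close>, which is at most \<open>E (h Y) + e\<close>.
\<close>

section \<open>Superharmonic functions\<close>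

text \<open>
  Lower semicontinuity and the boundary condition of upper functions are both lower bounds of this
  form. The real-valued reformulation keeps extended-real arithmetic out of the later arguments.
\<close>

lemma ereal_le_Liminf_iff:
  fixes u :: "'a \<Rightarrow> real"
  shows "ereal a \<le> Liminf F (\<lambda>x. ereal (u x)) \<longleftrightarrow> (\<forall>c<a. \<forall>\<^sub>F x in F. c < u x)"
proof -
  have "(\<forall>y<ereal a. \<forall>\<^sub>F x in F. y < ereal (u x)) \<longleftrightarrow> (\<forall>c<a. \<forall>\<^sub>F x in F. c < u x)"
  proof (intro iffI allI impI)
    fix c assume "\<forall>y<ereal a. \<forall>\<^sub>F x in F. y < ereal (u x)" "c < a"
    then have "\<forall>\<^sub>F x in F. ereal c < ereal (u x)" by (metis less_ereal.simps(1))
    then show "\<forall>\<^sub>F x in F. c < u x" by simp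
  next
    fix y assume "\<forall>c<a. \<forall>\<^sub>F x in F. c < u x" "y < ereal a"
    then show "\<forall>\<^sub>F x in F. y < ereal (u x)" by (cases y) auto
  qed
  then show ?thesis by (simp add: le_Liminf_iff)
qed

lemma Liminf_add_ge:
  fixes u v :: "'a \<Rightarrow> real"
  assumes "ereal a \<le> Liminf F (\<lambda>x. ereal (u x))" and "ereal b \<le> Liminf F (\<lambda>x. ereal (v x))"
  shows "ereal (a + b) \<le> Liminf F (\<lambda>x. ereal (u x + v x))"
  unfolding ereal_le_Liminf_iff
proof (intro allI impI)
  fix c assume c: "c < a + b"
  define e where "e = (a + b - c) / 2"
  have "a - e < a" "b - e < b" using c by (auto simp: e_def)
  with assms have "\<forall>\<^sub>F x in F. a - e < u x" "\<forall>\<^sub>F x in F. b - e < v x"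
    unfolding ereal_le_Liminf_iff by blast+
  then show "\<forall>\<^sub>F x in F. c < u x + v x"
    by eventually_elim (simp add: e_def field_simps)
qed

lemma Liminf_cmult_ge:
  fixes u :: "'a \<Rightarrow> real"
  assumes "ereal a \<le> Liminf F (\<lambda>x. ereal (u x))" and "0 \<le> c"
  shows "ereal (c * a) \<le> Liminf F (\<lambda>x. ereal (c * u x))"
proof (cases "c = 0")
  case True
  then show ?thesis by (simp add: ereal_le_Liminf_iff)
next
  case False
  with assms(2) have c: "0 < c" by simp
  show ?thesis
    unfolding ereal_le_Liminf_iff
  proof (intro allI impI)
    fix k assume "k < c * a"
    then have "k / c < a" using c by (simp add: field_simps)
    then have "\<forall>\<^sub>F x in F. k / c < u x" using assms(1) unfolding ereal_le_Liminf_iff by blast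
    then show "\<forall>\<^sub>F x in F. k < c * u x" using c by (simp add: field_simps)
  qed
qed

lemma tendsto_imp_le_Liminf:
  fixes u :: "'a \<Rightarrow> real"
  assumes "(u \<longlongrightarrow> a) F"
  shows "ereal a \<le> Liminf F (\<lambda>x. ereal (u x))"
  using order_tendstoD(1)[OF assms] unfolding ereal_le_Liminf_iff by blast

lemma superharmonic_on_add:
  assumes "superharmonic_on D u" and "superharmonic_on D v"
  shows "superharmonic_on D (\<lambda>x. u x + v x)"
  unfolding superharmonic_on_def
proof (intro conjI ballI allI impI)
  fix x assume "x \<in> D"
  with assms show "ereal (u x + v x) \<le> Liminf (at x) (\<lambda>y. ereal (u y + v y))"
    by (intro Liminf_add_ge) (auto simp: superharmonic_on_def)
next
  fix x r assume "0 < r" and "cball x r \<subseteq> D"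
  with assms have int: "set_integrable lborel (cball x r) u" "set_integrable lborel (cball x r) v"
    and "(LINT y:cball x r|lborel. u y) / measure lborel (cball x r) \<le> u x"
      "(LINT y:cball x r|lborel. v y) / measure lborel (cball x r) \<le> v x"
    unfolding superharmonic_on_def by blast+
  then show "(LINT y:cball x r|lborel. u y + v y) / measure lborel (cball x r) \<le> u x + v x"
    by (simp add: set_integral_add(2) add_divide_distrib)
  show "set_integrable lborel (cball x r) (\<lambda>y. u y + v y)"
    using int by (rule set_integral_add(1))
qed

lemma superharmonic_on_cmult:
  assumes "superharmonic_on D u" and "0 \<le> c"
  shows "superharmonic_on D (\<lambda>x. c * u x)"
  unfolding superharmonic_on_def
proof (intro conjI ballI allI impI)
  fix x assume "x \<in> D"
  with assms show "ereal (c * u x) \<le> Liminf (at x) (\<lambda>y. ereal (c * u y))"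
    by (intro Liminf_cmult_ge) (auto simp: superharmonic_on_def)
next
  fix x r assume "0 < r" and "cball x r \<subseteq> D"
  with assms(1) have int: "set_integrable lborel (cball x r) u"
    and avg: "(LINT y:cball x r|lborel. u y) / measure lborel (cball x r) \<le> u x"
    unfolding superharmonic_on_def by blast+
  show "(LINT y:cball x r|lborel. c * u y) / measure lborel (cball x r) \<le> c * u x"
    using mult_left_mono[OF avg \<open>0 \<le> c\<close>] by simp
  show "set_integrable lborel (cball x r) (\<lambda>y. c * u y)"
    using int by simp
qed

lemma lborel_distr_uminus_euclidean:
  "distr lborel borel uminus = (lborel :: 'a::euclidean_space measure)"
  using lborel_affine[of "-1" "0 :: 'a"] by (simp add: density_1)

text \<open>
  After moving the centre to the origin, the reflection \<open>y \<mapsto> - y\<close> preserves the ball and changes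
  the sign of the integrand. This is the mean value property of linear functions.
\<close>

lemma integral_cball_inner_centered:
  fixes b :: "'a::euclidean_space"
  shows "(LINT y:cball x r|lborel. (y - x) \<bullet> b) = 0"
proof -
  have "(LINT y:cball x r|lborel. (y - x) \<bullet> b)
      = (LINT y|distr lborel borel ((+) x). indicator (cball x r) y * ((y - x) \<bullet> b))"
    by (simp add: set_lebesgue_integral_def lborel_distr_plus)
  also have "\<dots> = (LINT y|lborel. indicator (cball 0 r) y * (y \<bullet> b))" (is "_ = ?J")
    by (subst integral_distr) (auto simp: indicator_def dist_norm intro!: Bochner_Integration.integral_cong)
  finally have J: "(LINT y:cball x r|lborel. (y - x) \<bullet> b) = ?J" .
  have "?J = (LINT y|distr lborel borel uminus. indicator (cball 0 r) y * (y \<bullet> b))"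
    by (simp add: lborel_distr_uminus_euclidean)
  also have "\<dots> = (LINT y|lborel. - (indicator (cball 0 r) y * (y \<bullet> b)))"
    by (subst integral_distr) (auto simp: indicator_def intro!: Bochner_Integration.integral_cong)
  also have "\<dots> = - ?J" by simp
  finally show ?thesis using J by simp
qed

lemma superharmonic_on_affine:
  fixes b :: "'a::euclidean_space"
  shows "superharmonic_on D (\<lambda>x. x \<bullet> b + c)"
  unfolding superharmonic_on_def
proof (intro conjI ballI allI impI)
  fix x assume "x \<in> D"
  show "ereal (x \<bullet> b + c) \<le> Liminf (at x) (\<lambda>y. ereal (y \<bullet> b + c))"
    by (intro tendsto_imp_le_Liminf tendsto_intros)
next
  fix x :: 'a and r :: real assume r: "0 < r"
  have int: "set_integrable lborel (cball x r) f" if "continuous_on UNIV f" for f :: "'a \<Rightarrow> real"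
    unfolding set_integrable_def
    using borel_integrable_compact[OF compact_cball continuous_on_subset[OF that]] by simp
  show "set_integrable lborel (cball x r) (\<lambda>y. y \<bullet> b + c)"
    by (intro int continuous_intros)
  have "(LINT y:cball x r|lborel. y \<bullet> b + c)
      = (LINT y:cball x r|lborel. (y - x) \<bullet> b + (x \<bullet> b + c))"
    by (simp add: inner_diff_left)
  also have "\<dots> = (LINT y:cball x r|lborel. (y - x) \<bullet> b) + (LINT y:cball x r|lborel. x \<bullet> b + c)"
    by (intro set_integral_add int continuous_intros)
  also have "\<dots> = measure lborel (cball x r) * (x \<bullet> b + c)"
    unfolding integral_cball_inner_centered by (simp add: set_lebesgue_integral_def)
  finally show "(LINT y:cball x r|lborel. y \<bullet> b + c) / measure lborel (cball x r) \<le> x \<bullet> b + c"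
    using content_cball_pos[OF r, of x] by simp
qed

section \<open>The minimum principle\<close>

text \<open>
  Lower semicontinuity alone makes sublevel sets closed relative to \<open>D\<close>; the boundary condition
  keeps those below \<open>a\<close> away from the frontier. For bounded \<open>D\<close> they are therefore compact, which
  is what makes a negative minimum attained.
\<close>

lemma closed_sublevel_set:
  assumes lsc: "\<And>x. x \<in> D \<Longrightarrow> ereal (v x) \<le> Liminf (at x) (\<lambda>y. ereal (v y))"
    and bd: "\<And>z. z \<in> frontier D \<Longrightarrow> ereal a \<le> Liminf (at z within D) (\<lambda>y. ereal (v y))"
    and "c < a"
  shows "closed {x\<in>D. v x \<le> c}"
  unfolding closed_limpt
proof (intro allI impI)
  fix z assume z: "z islimpt {x\<in>D. v x \<le> c}"
  then have freq: "\<not> (\<forall>\<^sub>F x in at z. x \<in> D \<longrightarrow> c < v x)"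
    unfolding islimpt_iff_eventually by (auto elim!: eventually_mono simp: not_le)
  have "z islimpt D" using z by (rule islimpt_subset) auto
  then have "z \<in> closure D" by (simp add: closure_def)
  have "z \<notin> frontier D"
  proof
    assume "z \<in> frontier D"
    then have "\<forall>\<^sub>F x in at z within D. c < v x"
      using bd \<open>c < a\<close> unfolding ereal_le_Liminf_iff by blast
    then have "\<forall>\<^sub>F x in at z. x \<in> D \<longrightarrow> c < v x"
      unfolding eventually_at_filter by (auto elim: eventually_mono)
    with freq show False ..
  qed
  with \<open>z \<in> closure D\<close> have "z \<in> D"
    using interior_subset by (auto simp: frontier_def)
  moreover have "v z \<le> c"
  proof (rule ccontr)
    assume "\<not> v z \<le> c"
    then have "\<forall>\<^sub>F x in at z. c < v x"
      using lsc[OF \<open>z \<in> D\<close>] unfolding ereal_le_Liminf_iff by simp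
    then have "\<forall>\<^sub>F x in at z. x \<in> D \<longrightarrow> c < v x" by (auto elim: eventually_mono)
    with freq show False ..
  qed
  ultimately show "z \<in> {x\<in>D. v x \<le> c}" by simp
qed

text \<open>
  The average of the nonnegative function \<open>v - v x\<close> over the ball is at most zero.
\<close>

lemma superharmonic_minimum_AE:
  fixes D :: "'a::euclidean_space set"
  assumes sup: "superharmonic_on D v" and "0 < r" and cb: "cball x r \<subseteq> D"
    and min: "\<And>y. y \<in> D \<Longrightarrow> v x \<le> v y"
  shows "AE y in lborel. y \<in> cball x r \<longrightarrow> v y = v x"
proof -
  let ?B = "cball x r"
  have int: "set_integrable lborel ?B v" and avg: "(LINT y:?B|lborel. v y) / measure lborel ?B \<le> v x"
    using sup \<open>0 < r\<close> cb unfolding superharmonic_on_def by auto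
  have int0: "set_integrable lborel ?B (\<lambda>_. v x)"
    unfolding set_integrable_def
    using borel_integrable_compact[OF compact_cball continuous_on_const[of ?B "v x"]] by simp
  have pos: "0 < measure lborel ?B" using content_cball_pos[OF \<open>0 < r\<close>, of x] by simp
  have int': "set_integrable lborel ?B (\<lambda>y. v y - v x)"
    using int int0 by (rule set_integral_diff)
  have nn: "0 \<le> indicator ?B y *\<^sub>R (v y - v x)" for y
    using cb min by (auto simp: indicator_def)
  have "(LINT y:?B|lborel. v y - v x) = (LINT y:?B|lborel. v y) - measure lborel ?B * v x"
    using set_integral_diff(2)[OF int int0] by (simp add: set_lebesgue_integral_def)
  also have "\<dots> \<le> 0" using avg pos by (simp add: field_simps)
  finally have "(LINT y|lborel. indicator ?B y *\<^sub>R (v y - v x)) = 0"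
    using integral_nonneg_AE[of "\<lambda>y. indicator ?B y *\<^sub>R (v y - v x)" lborel] nn
    unfolding set_lebesgue_integral_def by (simp add: antisym)
  then have "AE y in lborel. indicator ?B y *\<^sub>R (v y - v x) = 0"
    using integral_nonneg_eq_0_iff_AE[OF int'[unfolded set_integrable_def]] nn by simp
  then show ?thesis by (rule AE_mp) (auto intro!: AE_I2)
qed

text \<open>
  A negative infimum would be attained, on a compact set \<open>K\<close>. Around a point \<open>q\<close> of \<open>K\<close> that
  is extremal in some direction, an open half-ball misses \<open>K\<close>, although \<open>v\<close> takes its minimal
  value almost everywhere on the ball.
\<close>

lemma superharmonic_minimum_principle:
  fixes D :: "'a::euclidean_space set"
  assumes "open D" and "bounded D" and sup: "superharmonic_on D v"
    and bd: "\<And>z. z \<in> frontier D \<Longrightarrow> 0 \<le> Liminf (at z within D) (\<lambda>y. ereal (v y))"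
    and "x0 \<in> D"
  shows "0 \<le> v x0"
proof (rule ccontr)
  assume "\<not> 0 \<le> v x0"
  then have neg: "v x0 < 0" by simp
  have lsc: "\<And>x. x \<in> D \<Longrightarrow> ereal (v x) \<le> Liminf (at x) (\<lambda>y. ereal (v y))"
    using sup unfolding superharmonic_on_def by blast
  have compact: "compact {x\<in>D. v x \<le> c}" if "c < 0" for c
  proof -
    have "closed {x\<in>D. v x \<le> c}"
      using lsc bd that by (intro closed_sublevel_set[where a = 0]) (auto simp: zero_ereal_def)
    moreover have "bounded {x\<in>D. v x \<le> c}" using \<open>bounded D\<close> by (rule bounded_subset) auto
    ultimately show ?thesis by (simp add: compact_eq_bounded_closed)
  qed
  define I where "I = {y\<in>D. v y \<le> v x0}"
  have "compact I" unfolding I_def by (rule compact[OF neg])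
  \<comment> \<open>the sublevel sets at the values of \<open>v\<close> on \<open>I\<close> are nested compact sets, and a common point is a minimizer\<close>
  have "I \<inter> (\<Inter>y\<in>I. {x\<in>D. v x \<le> v y}) \<noteq> {}"
  proof (rule compact_imp_fip_image[OF \<open>compact I\<close>])
    fix y assume "y \<in> I"
    then show "closed {x\<in>D. v x \<le> v y}"
      using neg by (intro compact_imp_closed compact) (auto simp: I_def)
  next
    fix J assume J: "finite J" "J \<subseteq> I"
    show "I \<inter> (\<Inter>y\<in>J. {x\<in>D. v x \<le> v y}) \<noteq> {}"
    proof (cases "J = {}")
      case True
      then show ?thesis using \<open>x0 \<in> D\<close> by (auto simp: I_def)
    next
      case False
      then obtain j where "j \<in> J" "\<And>y. y \<in> J \<Longrightarrow> v j \<le> v y"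
        using ex_is_arg_min_if_finite[OF J(1), of v] by (auto simp: is_arg_min_linorder)
      then have "j \<in> I \<inter> (\<Inter>y\<in>J. {x\<in>D. v x \<le> v y})" using J(2) by (auto simp: I_def)
      then show ?thesis by blast
    qed
  qed
  then obtain p where p: "p \<in> I" "\<And>y. y \<in> I \<Longrightarrow> v p \<le> v y" by blast
  then have pmin: "v p \<le> v y" if "y \<in> D" for y
    using that by (cases "v y \<le> v x0") (auto simp: I_def)
  have "v p < 0" using p(1) neg by (auto simp: I_def)
  define K where "K = {x\<in>D. v x \<le> v p}"
  have "compact K" unfolding K_def by (rule compact[OF \<open>v p < 0\<close>])
  obtain b :: 'a where b: "b \<in> Basis" using nonempty_Basis by blast
  have "p \<in> K" using p(1) by (simp add: K_def I_def)
  moreover have "continuous_on K (\<lambda>y. y \<bullet> b)" by (intro continuous_intros)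
  ultimately obtain q where q: "q \<in> K" "\<And>y. y \<in> K \<Longrightarrow> y \<bullet> b \<le> q \<bullet> b"
    using continuous_attains_sup[OF \<open>compact K\<close>, of "\<lambda>y. y \<bullet> b"] by blast
  have vq: "v q = v p" "q \<in> D" using q(1) pmin by (auto simp: K_def intro: antisym)
  obtain r where r: "0 < r" "cball q r \<subseteq> D"
    using \<open>open D\<close> vq(2) open_contains_cball by blast
  define U where "U = ball q r \<inter> {y. q \<bullet> b < y \<bullet> b}"
  have "open U"
    unfolding U_def by (intro open_Int open_ball open_Collect_less continuous_intros)
  have "q + (r / 2) *\<^sub>R b \<in> U"
    using r(1) b by (auto simp: U_def dist_norm inner_add_left)
  have "AE y in lborel. y \<in> cball q r \<longrightarrow> v y = v q"
    using sup r pmin vq by (intro superharmonic_minimum_AE) auto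
  then have "AE y in lborel. y \<notin> U"
  proof (rule AE_mp, intro AE_I2 impI)
    fix y assume "y \<in> cball q r \<longrightarrow> v y = v q"
    then show "y \<notin> U" using q(2)[of y] r(2) vq(1) by (force simp: U_def K_def)
  qed
  then have "U \<in> null_sets lborel"
    using \<open>open U\<close> by (subst (asm) AE_iff_null_sets[symmetric]) auto
  then have "negligible U"
    by (simp add: negligible_iff_null_sets null_sets_completionI)
  with \<open>open U\<close> \<open>q + (r / 2) *\<^sub>R b \<in> U\<close> show False
    using open_not_negligible by blast
qed

section \<open>Comparison with upper functions\<close>

lemma upper_class_sum:
  assumes "finite I" and "\<And>i. i \<in> I \<Longrightarrow> u i \<in> upper_class D (f i)"
    and "\<And>i. i \<in> I \<Longrightarrow> 0 \<le> c i"
  shows "(\<lambda>x. \<Sum>i\<in>I. c i * u i x) \<in> upper_class D (\<lambda>z. \<Sum>i\<in>I. c i * f i z)"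
  using assms
proof (induction I rule: finite_induct)
  case empty
  then show ?case
    using superharmonic_on_affine[of D 0 0] by (simp add: upper_class_def ereal_le_Liminf_iff)
next
  case (insert i I)
  then have "u i \<in> upper_class D (f i)" "0 \<le> c i"
    "(\<lambda>x. \<Sum>i\<in>I. c i * u i x) \<in> upper_class D (\<lambda>z. \<Sum>i\<in>I. c i * f i z)" by auto
  then have "(\<lambda>x. c i * u i x + (\<Sum>i\<in>I. c i * u i x))
      \<in> upper_class D (\<lambda>z. c i * f i z + (\<Sum>i\<in>I. c i * f i z))"
    unfolding upper_class_def mem_Collect_eq
    by (intro conjI ballI superharmonic_on_add superharmonic_on_cmult Liminf_add_ge Liminf_cmult_ge)
      blast+
  then show ?case using insert.hyps by simp
qed

lemma subharmonic_le_upper_class: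
  fixes D :: "'a::euclidean_space set"
  assumes "open D" and "bounded D" and u: "u \<in> upper_class D f"
    and sub: "superharmonic_on D (\<lambda>x. - h x)" and cont: "continuous_on (closure D) h"
    and le: "\<And>z. z \<in> frontier D \<Longrightarrow> h z \<le> f z" and "x \<in> D"
  shows "h x \<le> u x"
proof -
  have "0 \<le> u x + - h x"
  proof (rule superharmonic_minimum_principle[OF \<open>open D\<close> \<open>bounded D\<close> _ _ \<open>x \<in> D\<close>])
    show "superharmonic_on D (\<lambda>x. u x + - h x)"
      using u sub by (intro superharmonic_on_add) (auto simp: upper_class_def)
  next
    fix z assume z: "z \<in> frontier D"
    have "(h \<longlongrightarrow> h z) (at z within D)"
    proof (rule tendsto_within_subset)
      show "(h \<longlongrightarrow> h z) (at z within closure D)"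
        using cont z by (auto simp: continuous_on_def frontier_def)
    qed (rule closure_subset)
    then have "ereal (- h z) \<le> Liminf (at z within D) (\<lambda>x. ereal (- h x))"
      by (intro tendsto_imp_le_Liminf tendsto_minus)
    moreover have "ereal (f z) \<le> Liminf (at z within D) (\<lambda>x. ereal (u x))"
      using u z by (auto simp: upper_class_def)
    ultimately have "ereal (f z + - h z) \<le> Liminf (at z within D) (\<lambda>x. ereal (u x + - h x))"
      by (intro Liminf_add_ge)
    moreover have "0 \<le> ereal (f z + - h z)" using le[OF z] by simp
    ultimately show "0 \<le> Liminf (at z within D) (\<lambda>x. ereal (u x + - h x))"
      by (rule order_trans[rotated])
  qed
  then show ?thesis by simp
qed

text \<open>
  Harmonic measure at \<open>x\<close> is an infimum over a nonempty class, so each of the finitely many sets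
  has an upper function that is nearly optimal at \<open>x\<close>. The weighted sum of these functions
  dominates \<open>h\<close>.
\<close>

lemma subharmonic_le_sum_harmonic_measure:
  fixes D :: "'a::euclidean_space set"
  assumes "open D" and "bounded D"
    and sub: "superharmonic_on D (\<lambda>x. - h x)" and cont: "continuous_on (closure D) h"
    and "finite I" and c: "\<And>i. i \<in> I \<Longrightarrow> 0 \<le> c i"
    and le: "\<And>z. z \<in> frontier D \<Longrightarrow> h z \<le> (\<Sum>i\<in>I. c i * indicator (E i) z)" and "x \<in> D"
  shows "h x \<le> (\<Sum>i\<in>I. c i * harmonic_measure x (E i) D)"
proof (rule field_le_epsilon)
  fix e :: real assume "0 < e"
  define s where "s = sum c I"
  have "0 \<le> s" using c by (simp add: s_def sum_nonneg)
  \<comment> \<open>the error allowed for each set; \<open>s + 1\<close> avoids division by zero when all weights vanish\<close>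
  define d where "d = e / (s + 1)"
  have "0 < d" using \<open>0 < e\<close> \<open>0 \<le> s\<close> by (simp add: d_def)
  \<comment> \<open>the constant \<open>1\<close> is an upper function, so the infimum is approached by values of the class\<close>
  have "\<exists>u\<in>upper_class D (indicator (E i)). u x < harmonic_measure x (E i) D + d" for i
  proof -
    have "(\<lambda>_. 1) \<in> upper_class D (indicator (E i))"
      using superharmonic_on_affine[of D 0 1]
      by (auto simp: upper_class_def ereal_le_Liminf_iff indicator_def)
    then have "(\<lambda>u. u x) ` upper_class D (indicator (E i)) \<noteq> {}" by blast
    moreover have "(INF u\<in>upper_class D (indicator (E i)). u x) < harmonic_measure x (E i) D + d"
      using \<open>0 < d\<close> by (simp add: harmonic_measure_def harmonic_extension_def)
    ultimately obtain y where "y \<in> (\<lambda>u. u x) ` upper_class D (indicator (E i))"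
      "y < harmonic_measure x (E i) D + d"
      by (rule cInf_lessD[THEN bexE])
    then show ?thesis by (elim imageE) (rule bexI, simp_all)
  qed
  then have "\<forall>i. \<exists>u. u \<in> upper_class D (indicator (E i)) \<and> u x < harmonic_measure x (E i) D + d"
    by blast
  from choice[OF this] obtain u where u: "\<And>i. u i \<in> upper_class D (indicator (E i))"
    "\<And>i. u i x < harmonic_measure x (E i) D + d" by blast
  have "h x \<le> (\<Sum>i\<in>I. c i * u i x)"
    using subharmonic_le_upper_class[OF \<open>open D\<close> \<open>bounded D\<close>
      upper_class_sum[OF \<open>finite I\<close> u(1) c] sub cont le \<open>x \<in> D\<close>] by simp
  also have "\<dots> \<le> (\<Sum>i\<in>I. c i * (harmonic_measure x (E i) D + d))"
    using u(2) c by (intro sum_mono mult_left_mono) (auto intro: less_imp_le)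
  also have "\<dots> = (\<Sum>i\<in>I. c i * harmonic_measure x (E i) D) + s * d"
    by (simp add: s_def algebra_simps sum.distrib sum_distrib_left)
  also have "s * d \<le> e"
    using \<open>0 < e\<close> \<open>0 \<le> s\<close> by (simp add: d_def field_simps)
  finally show "h x \<le> (\<Sum>i\<in>I. c i * harmonic_measure x (E i) D) + e" by simp
qed

section \<open>Expectations under harmonic measure\<close>

text \<open>
  The inequality for weighted sums of harmonic measures is applied to \<open>h + R \<ge> 0\<close>, rounded up
  on the frontier to the next multiple of \<open>e\<close>: the weights must be nonnegative, and the rounded
  function must lie above \<open>h + R\<close> for the comparison to apply.
\<close>

lemma subharmonic_le_expectation:
  fixes D :: "'a::euclidean_space set" and Y :: "'v \<Rightarrow> 'a"
  assumes "open D" and "bounded D" and "\<theta> \<in> D"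
    and "prob_space N" and Y: "harmonically_distributed N Y \<theta> D"
    and sub: "superharmonic_on D (\<lambda>x. - h x)" and cont: "continuous_on (closure D) h"
  shows "integrable N (\<lambda>w. h (Y w))" and "h \<theta> \<le> (LINT w|N. h (Y w))"
proof -
  interpret N: prob_space N by fact
  let ?F = "restrict_space borel (frontier D)"
  have Ym [measurable]: "Y \<in> borel_measurable N" and YF: "\<And>w. w \<in> space N \<Longrightarrow> Y w \<in> frontier D"
    and YE: "\<And>E. E \<in> sets borel \<Longrightarrow> E \<subseteq> frontier D \<Longrightarrow>
      measure N {w \<in> space N. Y w \<in> E} = harmonic_measure \<theta> E D"
    using Y unfolding harmonically_distributed_def by blast+
  have YmF: "Y \<in> measurable N ?F"
    using YF by (intro measurable_restrict_space2) auto
  have contF: "continuous_on (frontier D) h"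
    using cont by (rule continuous_on_subset) (auto simp: frontier_def)
  then have hm: "h \<in> borel_measurable ?F"
    by (rule borel_measurable_continuous_on_restrict)
  then have hY [measurable]: "(\<lambda>w. h (Y w)) \<in> borel_measurable N"
    by (rule measurable_compose[OF YmF])
  have "compact (frontier D)" using \<open>bounded D\<close> by (rule compact_frontier_bounded)
  then have "bounded (h ` frontier D)"
    using contF by (intro compact_imp_bounded compact_continuous_image)
  then obtain R where R: "\<And>z. z \<in> frontier D \<Longrightarrow> \<bar>h z\<bar> \<le> R"
    by (auto simp: bounded_iff)
  show int: "integrable N (\<lambda>w. h (Y w))"
    using R YF by (intro N.integrable_const_bound[where B = R]) auto
  show "h \<theta> \<le> (LINT w|N. h (Y w))"
  proof (rule field_le_epsilon)
    fix e :: real assume e: "0 < e"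
    define k where "k z = nat \<lceil>(h z + R) / e\<rceil>" for z
    define E where "E i = {z \<in> frontier D. k z = i}" for i
    define n where "n = nat \<lceil>(R + R) / e\<rceil>"
    have kn: "k z \<le> n" if "z \<in> frontier D" for z
      unfolding k_def n_def using R[OF that] e
      by (intro nat_mono ceiling_mono divide_right_mono) auto
    have k: "h z + R \<le> e * k z" "e * k z \<le> h z + R + e" if "z \<in> frontier D" for z
    proof -
      have "0 \<le> (h z + R) / e" using R[OF that] e by simp
      then have "real (k z) = of_int \<lceil>(h z + R) / e\<rceil>" by (simp add: k_def)
      then have "(h z + R) / e \<le> real (k z)" "real (k z) \<le> (h z + R) / e + 1" by linarith+
      then show "h z + R \<le> e * k z" "e * k z \<le> h z + R + e" using e by (auto simp: field_simps)
    qed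
    have simple: "(\<Sum>i\<le>n. e * real i * indicator (E i) z) = e * k z" if "z \<in> frontier D" for z
    proof -
      have "(\<Sum>i\<le>n. e * real i * indicator (E i) z) = (\<Sum>i\<le>n. if k z = i then e * real i else 0)"
        using that by (intro sum.cong) (auto simp: E_def)
      then show ?thesis using kn[OF that] by simp
    qed
    have E: "E i \<in> sets borel" "E i \<subseteq> frontier D" for i
    proof -
      have "k \<in> measurable ?F (count_space UNIV)" unfolding k_def using hm by measurable
      then have "k -` {i} \<inter> space ?F \<in> sets ?F" by (rule measurable_sets) simp
      moreover have "k -` {i} \<inter> space ?F = E i" by (auto simp: E_def space_restrict_space)
      ultimately show "E i \<in> sets borel" by (simp add: sets_restrict_space_iff)
    qed (auto simp: E_def)
    \<comment> \<open>a constant enters as an affine function with zero linear part\<close>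
    have "superharmonic_on D (\<lambda>x. - h x + (x \<bullet> 0 + - R))"
      by (intro superharmonic_on_add sub superharmonic_on_affine)
    then have sub': "superharmonic_on D (\<lambda>x. - (h x + R))" by simp
    have "h \<theta> + R \<le> (\<Sum>i\<le>n. e * real i * harmonic_measure \<theta> (E i) D)"
    proof (rule subharmonic_le_sum_harmonic_measure[OF \<open>open D\<close> \<open>bounded D\<close> sub'])
      show "continuous_on (closure D) (\<lambda>x. h x + R)" by (intro continuous_intros cont)
    qed (use e k(1) simple \<open>\<theta> \<in> D\<close> in auto)
    also have "\<dots> = (\<Sum>i\<le>n. e * real i * (LINT w|N. indicator (E i) (Y w)))"
    proof (intro sum.cong refl)
      fix i
      have "(LINT w|N. indicator (E i) (Y w)) = (LINT w|N. indicator {w \<in> space N. Y w \<in> E i} w)"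
        by (intro Bochner_Integration.integral_cong) (auto simp: indicator_def)
      also have "\<dots> = measure N {w \<in> space N. Y w \<in> E i}"
        by (simp add: Int_def conj_commute)
      finally show "e * real i * harmonic_measure \<theta> (E i) D = e * real i * (LINT w|N. indicator (E i) (Y w))"
        using YE[OF E, of i] by simp
    qed
    also have "\<dots> = (LINT w|N. (\<Sum>i\<le>n. e * real i * indicator (E i) (Y w)))"
    proof (subst Bochner_Integration.integral_sum)
      fix i
      have [measurable]: "E i \<in> sets borel" by (rule E)
      show "integrable N (\<lambda>w. e * real i * indicator (E i) (Y w))"
        by (intro integrable_mult_right N.integrable_const_bound[where B = 1]) auto
    qed simp
    also have "\<dots> = (LINT w|N. e * k (Y w))"
      using simple YF by (intro Bochner_Integration.integral_cong) auto
    also have "\<dots> \<le> (LINT w|N. h (Y w) + (R + e))"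
    proof (rule integral_mono)
      have [measurable]: "(\<lambda>w. k (Y w)) \<in> measurable N (count_space UNIV)"
        unfolding k_def by measurable
      show "integrable N (\<lambda>w. e * k (Y w))"
        using kn YF e by (intro N.integrable_const_bound[where B = "e * n"]) auto
      show "integrable N (\<lambda>w. h (Y w) + (R + e))"
        using int by simp
    qed (use k(2) YF in force)
    also have "\<dots> = (LINT w|N. h (Y w)) + (R + e)"
      using int by (simp add: N.prob_space)
    finally show "h \<theta> \<le> (LINT w|N. h (Y w)) + e" by simp
  qed
qed

theorem lemma1:
  fixes M :: "'w measure" and W :: "real \<Rightarrow> 'w \<Rightarrow> real ^ 'd"
    and D :: "(real ^ 'd) set" and \<theta> :: "real ^ 'd"
    and N :: "'v measure" and Y :: "'v \<Rightarrow> real ^ 'd"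
  assumes "standard_brownian_motion M W"
    and "regular_domain M W D" and "bounded D" and "\<theta> \<in> D"
    and "prob_space N" and "harmonically_distributed N Y \<theta> D"
  shows "integrable N Y \<and> prob_space.expectation N Y = \<theta>"
proof -
  interpret N: prob_space N by fact
  have "open D" using assms(2) by (simp add: regular_domain_def domain_def)
  have sup: "superharmonic_on D (\<lambda>x. - (x \<bullet> b))" for b
    using superharmonic_on_affine[of D "- b" 0] by simp
  have cont: "continuous_on (closure D) (\<lambda>x. x \<bullet> b)" for b by (intro continuous_intros)
  note below = subharmonic_le_expectation[OF \<open>open D\<close> assms(3-6) sup cont]
  have int_coord: "integrable N (\<lambda>w. Y w \<bullet> b)" for b by (rule below(1))
  have "integrable N (\<lambda>w. \<Sum>b\<in>Basis. (Y w \<bullet> b) *\<^sub>R b)"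
    by (intro Bochner_Integration.integrable_sum integrable_scaleR_left int_coord)
  then have int: "integrable N Y" by (simp add: euclidean_representation)
  moreover have "integral\<^sup>L N Y = \<theta>"
  proof (rule euclidean_eqI)
    fix b :: "real ^ 'd"
    have "\<theta> \<bullet> b \<le> (LINT w|N. Y w \<bullet> b)" by (rule below(2))
    moreover have "\<theta> \<bullet> (- b) \<le> (LINT w|N. Y w \<bullet> (- b))" by (rule below(2))
    ultimately have "(LINT w|N. Y w \<bullet> b) = \<theta> \<bullet> b" by simp
    then show "integral\<^sup>L N Y \<bullet> b = \<theta> \<bullet> b" using int by simp
  qed
  ultimately show ?thesis by simp
qed

end
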